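(* The variety of $\mathsf V$-algebras is the equivalent algebraic semantics (in the sense of Blok–Pigozzi) of $\mathbf{GV}$.
   Context: A $\mathsf V$-algebra (Lewis variably strict conditional algebra) is an algebra $(C,\wedge,\vee,\to,\mathbin{\Box\!\!\rightarrow},0,1)$ where $(C,\wedge,\vee,\to,0,1)$ is a Boolean algebra and $\mathbin{\Box\!\!\rightarrow}$ is a binary operation such that for all $x,y,z$: (1) $x\mathbin{\Box\!\!\rightarrow}x=1$; (2) $((x\mathbin{\Box\!\!\rightarrow}y)\wedge(y\mathbin{\Box\!\!\rightarrow}x))\le((x\mathbin{\Box\!\!\rightarrow}z)\leftrightarrow(y\mathbin{\Box\!\!\rightarrow}z))$; (3) $((x\vee y)\mathbin{\Box\!\!\rightarrow}x)\vee((x\vee y)\mathbin{\Box\!\!\rightarrow}y)\vee(((x\vee y)\mathbin{\Box\!\!\rightarrow}z)\leftrightarrow((x\mathbin{\Box\!\!\rightarrow}z)\wedge(y\mathbin{\Box\!\!\rightarrow}z)))=1$; (4) $x\mathbin{\Box\!\!\rightarrow}(y\wedge z)=(x\mathbin{\Box\!\!\rightarrow}y)\wedge(x\mathbin{\Box\!\!\rightarrow}z)$. $\mathbf{GV}$ is the smallest finitary consequence relation in the language $\{\land,\lor,\to,\mathbin{\Box\!\!\rightarrow},0,1\}$ containing classical propositional axioms and (L1) $\varphi\mathbin{\Box\!\!\rightarrow}\varphi$, (L2) $((\varphi\mathbin{\Box\!\!\rightarrow}\psi)\wedge(\psi\mathbin{\Box\!\!\rightarrow}\varphi))\to((\varphi\mathbin{\Box\!\!\rightarrow}\gamma)\leftrightarrow(\psi\mathbin{\Box\!\!\rightarrow}\gamma))$,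 (L3) $((\varphi\vee\psi)\mathbin{\Box\!\!\rightarrow}\varphi)\vee((\varphi\vee\psi)\mathbin{\Box\!\!\rightarrow}\psi)\vee(((\varphi\vee\psi)\mathbin{\Box\!\!\rightarrow}\gamma)\leftrightarrow((\varphi\mathbin{\Box\!\!\rightarrow}\gamma)\wedge(\psi\mathbin{\Box\!\!\rightarrow}\gamma)))$, (L4) $(\varphi\mathbin{\Box\!\!\rightarrow}(\psi\land\gamma))\leftrightarrow((\varphi\mathbin{\Box\!\!\rightarrow}\psi)\land(\varphi\mathbin{\Box\!\!\rightarrow}\gamma))$, and closed under modus ponens and (C) $\varphi\to\psi\vdash(\gamma\mathbin{\Box\!\!\rightarrow}\varphi)\to(\gamma\mathbin{\Box\!\!\rightarrow}\psi)$. Equivalent algebraic semantics is witnessed by the defining equation $\tau(x)=\{x\approx1\}$ and equivalence formula $\Delta(x,y)=\{x\leftrightarrow y\}$: $\Gamma\vdash_{\mathbf{GV}}\varphi$ iff $\tau(\Gamma)\models\tau(\varphi)$ in the class, and $x\approx y$ is interderivable with $\tau(\Delta(x,y))$. *)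

theory Defs
  imports Main
begin

section \<open>Formulas\<close>

datatype fm =
    Var nat
  | Fls  (\<open>\<^bold>0\<close>)
  | Tru  (\<open>\<^bold>1\<close>)
  | Con fm fm  (infixr \<open>\<^bold>\<and>\<close> 75)
  | Dis fm fm  (infixr \<open>\<^bold>\<or>\<close> 70)
  | Imp fm fm  (infixr \<open>\<^bold>\<rightarrow>\<close> 65)
  | Cnd fm fm  (infix \<open>\<^bold>\<box>\<rightarrow>\<close> 80)

abbreviation Iff :: "fm \<Rightarrow> fm \<Rightarrow> fm"  (infix \<open>\<^bold>\<leftrightarrow>\<close> 65) where
  "\<phi> \<^bold>\<leftrightarrow> \<psi> \<equiv> (\<phi> \<^bold>\<rightarrow> \<psi>) \<^bold>\<and> (\<psi> \<^bold>\<rightarrow> \<phi>)"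

primrec subst :: "(nat \<Rightarrow> fm) \<Rightarrow> fm \<Rightarrow> fm" where
  "subst \<sigma> (Var n) = \<sigma> n"
| "subst \<sigma> \<^bold>0 = \<^bold>0"
| "subst \<sigma> \<^bold>1 = \<^bold>1"
| "subst \<sigma> (\<phi> \<^bold>\<and> \<psi>) = subst \<sigma> \<phi> \<^bold>\<and> subst \<sigma> \<psi>"
| "subst \<sigma> (\<phi> \<^bold>\<or> \<psi>) = subst \<sigma> \<phi> \<^bold>\<or> subst \<sigma> \<psi>"
| "subst \<sigma> (\<phi> \<^bold>\<rightarrow> \<psi>) = subst \<sigma> \<phi> \<^bold>\<rightarrow> subst \<sigma> \<psi>"
| "subst \<sigma> (\<phi> \<^bold>\<box>\<rightarrow> \<psi>) = subst \<sigma> \<phi> \<^bold>\<box>\<rightarrow> subst \<sigma> \<psi>"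

primrec vars :: "fm \<Rightarrow> nat set" where
  "vars (Var n) = {n}"
| "vars \<^bold>0 = {}"
| "vars \<^bold>1 = {}"
| "vars (\<phi> \<^bold>\<and> \<psi>) = vars \<phi> \<union> vars \<psi>"
| "vars (\<phi> \<^bold>\<or> \<psi>) = vars \<phi> \<union> vars \<psi>"
| "vars (\<phi> \<^bold>\<rightarrow> \<psi>) = vars \<phi> \<union> vars \<psi>"
| "vars (\<phi> \<^bold>\<box>\<rightarrow> \<psi>) = vars \<phi> \<union> vars \<psi>"


section \<open>The logic GV\<close>

type_synonym conseq = "fm set \<Rightarrow> fm \<Rightarrow> bool"

definition finitary_consequence_relation :: "conseq \<Rightarrow> bool" where
  "finitary_consequence_relation R \<longleftrightarrow>
     (\<forall>\<Gamma> \<phi>. \<phi> \<in> \<Gamma> \<longrightarrow> R \<Gamma> \<phi>) \<and>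
     (\<forall>\<Gamma> \<Delta> \<phi>. \<Gamma> \<subseteq> \<Delta> \<longrightarrow> R \<Gamma> \<phi> \<longrightarrow> R \<Delta> \<phi>) \<and>
     (\<forall>\<Gamma> \<Delta> \<phi>. (\<forall>\<psi>\<in>\<Delta>. R \<Gamma> \<psi>) \<longrightarrow> R \<Delta> \<phi> \<longrightarrow> R \<Gamma> \<phi>) \<and>
     (\<forall>\<Gamma> \<phi>. R \<Gamma> \<phi> \<longrightarrow> (\<exists>\<Gamma>\<^sub>0. finite \<Gamma>\<^sub>0 \<and> \<Gamma>\<^sub>0 \<subseteq> \<Gamma> \<and> R \<Gamma>\<^sub>0 \<phi>))"

text \<open>A standard Hilbert-style axiomatization, with modus ponens, of classical propositional
  logic in the signature with primitive constants and no primitive negation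
  (the negation of \<open>\<phi>\<close> is \<open>\<phi> \<^bold>\<rightarrow> \<^bold>0\<close>).\<close>

inductive_set classical_axioms :: "fm set" where
  "\<phi> \<^bold>\<rightarrow> (\<psi> \<^bold>\<rightarrow> \<phi>) \<in> classical_axioms"
| "(\<phi> \<^bold>\<rightarrow> (\<psi> \<^bold>\<rightarrow> \<gamma>)) \<^bold>\<rightarrow> ((\<phi> \<^bold>\<rightarrow> \<psi>) \<^bold>\<rightarrow> (\<phi> \<^bold>\<rightarrow> \<gamma>)) \<in> classical_axioms"
| "(\<phi> \<^bold>\<and> \<psi>) \<^bold>\<rightarrow> \<phi> \<in> classical_axioms"
| "(\<phi> \<^bold>\<and> \<psi>) \<^bold>\<rightarrow> \<psi> \<in> classical_axioms"
| "\<phi> \<^bold>\<rightarrow> (\<psi> \<^bold>\<rightarrow> (\<phi> \<^bold>\<and> \<psi>)) \<in> classical_axioms"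
| "\<phi> \<^bold>\<rightarrow> (\<phi> \<^bold>\<or> \<psi>) \<in> classical_axioms"
| "\<psi> \<^bold>\<rightarrow> (\<phi> \<^bold>\<or> \<psi>) \<in> classical_axioms"
| "(\<phi> \<^bold>\<rightarrow> \<gamma>) \<^bold>\<rightarrow> ((\<psi> \<^bold>\<rightarrow> \<gamma>) \<^bold>\<rightarrow> ((\<phi> \<^bold>\<or> \<psi>) \<^bold>\<rightarrow> \<gamma>)) \<in> classical_axioms"
| "\<^bold>0 \<^bold>\<rightarrow> \<phi> \<in> classical_axioms"
| "\<^bold>1 \<in> classical_axioms"
| "((\<phi> \<^bold>\<rightarrow> \<^bold>0) \<^bold>\<rightarrow> \<^bold>0) \<^bold>\<rightarrow> \<phi> \<in> classical_axioms"

inductive_set lewis_axioms :: "fm set" where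
  L1: "\<phi> \<^bold>\<box>\<rightarrow> \<phi> \<in> lewis_axioms"
| L2: "((\<phi> \<^bold>\<box>\<rightarrow> \<psi>) \<^bold>\<and> (\<psi> \<^bold>\<box>\<rightarrow> \<phi>)) \<^bold>\<rightarrow> ((\<phi> \<^bold>\<box>\<rightarrow> \<gamma>) \<^bold>\<leftrightarrow> (\<psi> \<^bold>\<box>\<rightarrow> \<gamma>)) \<in> lewis_axioms"
| L3: "((\<phi> \<^bold>\<or> \<psi>) \<^bold>\<box>\<rightarrow> \<phi>) \<^bold>\<or> ((\<phi> \<^bold>\<or> \<psi>) \<^bold>\<box>\<rightarrow> \<psi>) \<^bold>\<or>
         (((\<phi> \<^bold>\<or> \<psi>) \<^bold>\<box>\<rightarrow> \<gamma>) \<^bold>\<leftrightarrow> ((\<phi> \<^bold>\<box>\<rightarrow> \<gamma>) \<^bold>\<and> (\<psi> \<^bold>\<box>\<rightarrow> \<gamma>))) \<in> lewis_axioms"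
| L4: "(\<phi> \<^bold>\<box>\<rightarrow> (\<psi> \<^bold>\<and> \<gamma>)) \<^bold>\<leftrightarrow> ((\<phi> \<^bold>\<box>\<rightarrow> \<psi>) \<^bold>\<and> (\<phi> \<^bold>\<box>\<rightarrow> \<gamma>)) \<in> lewis_axioms"

definition GV_closed :: "conseq \<Rightarrow> bool" where
  "GV_closed R \<longleftrightarrow>
     (\<forall>\<phi> \<in> classical_axioms \<union> lewis_axioms. R {} \<phi>) \<and>
     (\<forall>\<phi> \<psi>. R {\<phi>, \<phi> \<^bold>\<rightarrow> \<psi>} \<psi>) \<and>
     (\<forall>\<phi> \<psi> \<gamma>. R {\<phi> \<^bold>\<rightarrow> \<psi>} ((\<gamma> \<^bold>\<box>\<rightarrow> \<phi>) \<^bold>\<rightarrow> (\<gamma> \<^bold>\<box>\<rightarrow> \<psi>)))"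

text \<open>The intersection of all finitary consequence relations satisfying the closure conditions.
  Finitariness is not preserved by arbitrary intersections; that the intersection is nevertheless
  one of these relations, hence the smallest, is \<open>GV_least\<close> below.\<close>

definition GV :: conseq where
  "GV \<Gamma> \<phi> \<longleftrightarrow> (\<forall>R. finitary_consequence_relation R \<and> GV_closed R \<longrightarrow> R \<Gamma> \<phi>)"

inductive derivable :: "fm set \<Rightarrow> fm \<Rightarrow> bool" for \<Gamma> :: "fm set" where
  hyp: "\<phi> \<in> \<Gamma> \<Longrightarrow> derivable \<Gamma> \<phi>"
| ax: "\<phi> \<in> classical_axioms \<union> lewis_axioms \<Longrightarrow> derivable \<Gamma> \<phi>"
| mp: "derivable \<Gamma> \<phi> \<Longrightarrow> derivable \<Gamma> (\<phi> \<^bold>\<rightarrow> \<psi>) \<Longrightarrow> derivable \<Gamma> \<psi>"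
| C: "derivable \<Gamma> (\<phi> \<^bold>\<rightarrow> \<psi>) \<Longrightarrow> derivable \<Gamma> ((\<gamma> \<^bold>\<box>\<rightarrow> \<phi>) \<^bold>\<rightarrow> (\<gamma> \<^bold>\<box>\<rightarrow> \<psi>))"

lemma derivable_mono: "derivable \<Gamma> \<phi> \<Longrightarrow> \<Gamma> \<subseteq> \<Delta> \<Longrightarrow> derivable \<Delta> \<phi>"
  by (induction rule: derivable.induct)
    (blast intro: derivable.hyp, rule derivable.ax, assumption,
      rule derivable.mp, simp, simp, rule derivable.C, simp)

lemma derivable_cut: "derivable \<Delta> \<phi> \<Longrightarrow> \<forall>\<psi>\<in>\<Delta>. derivable \<Gamma> \<psi> \<Longrightarrow> derivable \<Gamma> \<phi>"
  by (induction rule: derivable.induct)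
    (blast intro: derivable.hyp, rule derivable.ax, assumption,
      rule derivable.mp, simp, simp, rule derivable.C, simp)

lemma derivable_finitary:
  "derivable \<Gamma> \<phi> \<Longrightarrow> \<exists>\<Gamma>\<^sub>0. finite \<Gamma>\<^sub>0 \<and> \<Gamma>\<^sub>0 \<subseteq> \<Gamma> \<and> derivable \<Gamma>\<^sub>0 \<phi>"
proof (induction rule: derivable.induct)
  case (hyp \<phi>)
  then show ?case by (intro exI[of _ "{\<phi>}"]) (simp add: derivable.hyp)
next
  case (ax \<phi>)
  then show ?case by (intro exI[of _ "{}"]) (simp add: derivable.ax)
next
  case (mp \<phi> \<psi>)
  then obtain \<Gamma>\<^sub>1 \<Gamma>\<^sub>2 where
    fin: "finite \<Gamma>\<^sub>1" "\<Gamma>\<^sub>1 \<subseteq> \<Gamma>" "derivable \<Gamma>\<^sub>1 \<phi>" "finite \<Gamma>\<^sub>2" "\<Gamma>\<^sub>2 \<subseteq> \<Gamma>" "derivable \<Gamma>\<^sub>2 (\<phi> \<^bold>\<rightarrow> \<psi>)"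
    by blast
  then have "derivable (\<Gamma>\<^sub>1 \<union> \<Gamma>\<^sub>2) \<psi>"
    by (intro derivable.mp[of _ \<phi> \<psi>]) (rule derivable_mono, assumption, blast)+
  with fin show ?case by (intro exI[of _ "\<Gamma>\<^sub>1 \<union> \<Gamma>\<^sub>2"]) simp
next
  case (C \<phi> \<psi> \<gamma>)
  then show ?case by (blast intro: derivable.C)
qed

lemma finitary_consequence_relation_derivable: "finitary_consequence_relation derivable"
  unfolding finitary_consequence_relation_def
  by (intro conjI allI impI)
    (erule derivable.hyp, erule (1) derivable_mono[rotated], erule (1) derivable_cut[rotated],
      erule derivable_finitary)

lemma GV_closed_derivable: "GV_closed derivable"
proof -
  have "derivable {\<phi>, \<phi> \<^bold>\<rightarrow> \<psi>} \<psi>" for \<phi> \<psi>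
    by (rule derivable.mp[of _ \<phi>]) (simp_all add: derivable.hyp)
  then show ?thesis
    unfolding GV_closed_def by (simp add: derivable.ax derivable.hyp derivable.C)
qed

lemma derivable_least:
  assumes R: "finitary_consequence_relation R" "GV_closed R" and "derivable \<Gamma> \<phi>"
  shows "R \<Gamma> \<phi>"
proof -
  have refl: "\<forall>\<Gamma> \<phi>. \<phi> \<in> \<Gamma> \<longrightarrow> R \<Gamma> \<phi>"
    and mono: "\<forall>\<Gamma> \<Delta> \<phi>. \<Gamma> \<subseteq> \<Delta> \<longrightarrow> R \<Gamma> \<phi> \<longrightarrow> R \<Delta> \<phi>"
    and cut: "\<forall>\<Gamma> \<Delta> \<phi>. (\<forall>\<psi>\<in>\<Delta>. R \<Gamma> \<psi>) \<longrightarrow> R \<Delta> \<phi> \<longrightarrow> R \<Gamma> \<phi>"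
    using R(1) unfolding finitary_consequence_relation_def by - (elim conjE, assumption)+
  have axR: "\<forall>\<phi> \<in> classical_axioms \<union> lewis_axioms. R {} \<phi>"
    and mpR: "\<forall>\<phi> \<psi>. R {\<phi>, \<phi> \<^bold>\<rightarrow> \<psi>} \<psi>"
    and CR: "\<forall>\<phi> \<psi> \<gamma>. R {\<phi> \<^bold>\<rightarrow> \<psi>} ((\<gamma> \<^bold>\<box>\<rightarrow> \<phi>) \<^bold>\<rightarrow> (\<gamma> \<^bold>\<box>\<rightarrow> \<psi>))"
    using R(2) unfolding GV_closed_def by - (elim conjE, assumption)+
  show ?thesis
    using assms(3)
  proof (induction rule: derivable.induct)
    case (hyp \<phi>)
    then show ?case by (rule refl[rule_format])
  next
    case (ax \<phi>)
    then show ?case by (rule mono[rule_format, OF empty_subsetI axR[rule_format]])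
  next
    case (mp \<phi> \<psi>)
    then have "\<forall>\<chi>\<in>{\<phi>, \<phi> \<^bold>\<rightarrow> \<psi>}. R \<Gamma> \<chi>" by simp
    then show ?case using cut mpR by blast
  next
    case (C \<phi> \<psi> \<gamma>)
    then have "\<forall>\<chi>\<in>{\<phi> \<^bold>\<rightarrow> \<psi>}. R \<Gamma> \<chi>" by simp
    then show ?case using cut CR by blast
  qed
qed

lemma GV_eq_derivable: "GV = derivable"
proof (intro ext iffI)
  fix \<Gamma> \<phi>
  show "derivable \<Gamma> \<phi>" if "GV \<Gamma> \<phi>"
    using that[unfolded GV_def, THEN spec[of _ derivable]]
      finitary_consequence_relation_derivable GV_closed_derivable by simp
  show "GV \<Gamma> \<phi>" if "derivable \<Gamma> \<phi>"
    unfolding GV_def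
  proof (intro allI impI, elim conjE)
    fix R
    assume "finitary_consequence_relation R" "GV_closed R"
    then show "R \<Gamma> \<phi>" using that by (rule derivable_least)
  qed
qed

lemma GV_least:
  "finitary_consequence_relation GV" "GV_closed GV"
  "finitary_consequence_relation R \<Longrightarrow> GV_closed R \<Longrightarrow> GV \<Gamma> \<phi> \<Longrightarrow> R \<Gamma> \<phi>"
  unfolding GV_eq_derivable
  by (rule finitary_consequence_relation_derivable, rule GV_closed_derivable, rule derivable_least)

lemma classical_axioms_subst: "\<phi> \<in> classical_axioms \<Longrightarrow> subst \<sigma> \<phi> \<in> classical_axioms"
  by (induction rule: classical_axioms.induct) (simp_all add: classical_axioms.intros)

lemma lewis_axioms_subst: "\<phi> \<in> lewis_axioms \<Longrightarrow> subst \<sigma> \<phi> \<in> lewis_axioms"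
  by (induction rule: lewis_axioms.induct) (simp_all add: lewis_axioms.intros)

lemma GV_subst: "GV \<Gamma> \<phi> \<Longrightarrow> GV (subst \<sigma> ` \<Gamma>) (subst \<sigma> \<phi>)"
  unfolding GV_eq_derivable
proof (induction rule: derivable.induct)
  case (ax \<phi>)
  then show ?case
    using classical_axioms_subst lewis_axioms_subst by (blast intro: derivable.ax)
next
  case (mp \<phi> \<psi>)
  then show ?case by (intro derivable.mp[of _ "subst \<sigma> \<phi>" "subst \<sigma> \<psi>"]) simp_all
qed (simp_all add: derivable.hyp derivable.C)


section \<open>V-algebras\<close>

record 'a alg =
  carrier :: "'a set"
  meet :: "'a \<Rightarrow> 'a \<Rightarrow> 'a"  (infixl \<open>\<sqinter>\<index>\<close> 70)
  join :: "'a \<Rightarrow> 'a \<Rightarrow> 'a"  (infixl \<open>\<squnion>\<index>\<close> 65)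
  impl :: "'a \<Rightarrow> 'a \<Rightarrow> 'a"  (infixr \<open>\<Rightarrow>\<index>\<close> 60)
  cond :: "'a \<Rightarrow> 'a \<Rightarrow> 'a"  (infix \<open>\<box>\<rightarrow>\<index>\<close> 75)
  zero :: 'a  (\<open>\<zero>\<index>\<close>)
  one :: 'a  (\<open>\<one>\<index>\<close>)

locale algebra =
  fixes A :: "'a alg" (structure)
  assumes zero_closed: "\<zero> \<in> carrier A"
    and one_closed: "\<one> \<in> carrier A"
    and meet_closed: "x \<in> carrier A \<Longrightarrow> y \<in> carrier A \<Longrightarrow> x \<sqinter> y \<in> carrier A"
    and join_closed: "x \<in> carrier A \<Longrightarrow> y \<in> carrier A \<Longrightarrow> x \<squnion> y \<in> carrier A"
    and impl_closed: "x \<in> carrier A \<Longrightarrow> y \<in> carrier A \<Longrightarrow> x \<Rightarrow> y \<in> carrier A"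
    and cond_closed: "x \<in> carrier A \<Longrightarrow> y \<in> carrier A \<Longrightarrow> x \<box>\<rightarrow> y \<in> carrier A"

text \<open>Boolean algebras in the signature without complement: the complement of \<open>x\<close> is
  \<open>x \<Rightarrow> \<zero>\<close>. The one-element algebra is allowed.\<close>

locale boolean_alg = algebra +
  assumes meet_assoc: "\<lbrakk>x \<in> carrier A; y \<in> carrier A; z \<in> carrier A\<rbrakk>
      \<Longrightarrow> (x \<sqinter> y) \<sqinter> z = x \<sqinter> (y \<sqinter> z)"
    and join_assoc: "\<lbrakk>x \<in> carrier A; y \<in> carrier A; z \<in> carrier A\<rbrakk>
      \<Longrightarrow> (x \<squnion> y) \<squnion> z = x \<squnion> (y \<squnion> z)"
    and meet_commute: "\<lbrakk>x \<in> carrier A; y \<in> carrier A\<rbrakk> \<Longrightarrow> x \<sqinter> y = y \<sqinter> x"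
    and join_commute: "\<lbrakk>x \<in> carrier A; y \<in> carrier A\<rbrakk> \<Longrightarrow> x \<squnion> y = y \<squnion> x"
    and meet_absorb: "\<lbrakk>x \<in> carrier A; y \<in> carrier A\<rbrakk> \<Longrightarrow> x \<sqinter> (x \<squnion> y) = x"
    and join_absorb: "\<lbrakk>x \<in> carrier A; y \<in> carrier A\<rbrakk> \<Longrightarrow> x \<squnion> (x \<sqinter> y) = x"
    and meet_distrib: "\<lbrakk>x \<in> carrier A; y \<in> carrier A; z \<in> carrier A\<rbrakk>
      \<Longrightarrow> x \<sqinter> (y \<squnion> z) = (x \<sqinter> y) \<squnion> (x \<sqinter> z)"
    and join_distrib: "\<lbrakk>x \<in> carrier A; y \<in> carrier A; z \<in> carrier A\<rbrakk>
      \<Longrightarrow> x \<squnion> (y \<sqinter> z) = (x \<squnion> y) \<sqinter> (x \<squnion> z)"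
    and join_zero: "x \<in> carrier A \<Longrightarrow> x \<squnion> \<zero> = x"
    and meet_one: "x \<in> carrier A \<Longrightarrow> x \<sqinter> \<one> = x"
    and meet_compl: "x \<in> carrier A \<Longrightarrow> x \<sqinter> (x \<Rightarrow> \<zero>) = \<zero>"
    and join_compl: "x \<in> carrier A \<Longrightarrow> x \<squnion> (x \<Rightarrow> \<zero>) = \<one>"
    and impl_eq: "\<lbrakk>x \<in> carrier A; y \<in> carrier A\<rbrakk> \<Longrightarrow> x \<Rightarrow> y = (x \<Rightarrow> \<zero>) \<squnion> y"
begin

definition leq :: "'a \<Rightarrow> 'a \<Rightarrow> bool"  (infix \<open>\<sqsubseteq>\<close> 50) where
  "x \<sqsubseteq> y \<longleftrightarrow> x \<sqinter> y = x"

definition biimpl :: "'a \<Rightarrow> 'a \<Rightarrow> 'a"  (infix \<open>\<Leftrightarrow>\<close> 60) where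
  "x \<Leftrightarrow> y = (x \<Rightarrow> y) \<sqinter> (y \<Rightarrow> x)"

end

locale V_algebra = boolean_alg +
  assumes cond_refl: "x \<in> carrier A \<Longrightarrow> x \<box>\<rightarrow> x = \<one>"
    and cond_cong: "\<lbrakk>x \<in> carrier A; y \<in> carrier A; z \<in> carrier A\<rbrakk>
      \<Longrightarrow> (x \<box>\<rightarrow> y) \<sqinter> (y \<box>\<rightarrow> x) \<sqsubseteq> ((x \<box>\<rightarrow> z) \<Leftrightarrow> (y \<box>\<rightarrow> z))"
    and cond_join: "\<lbrakk>x \<in> carrier A; y \<in> carrier A; z \<in> carrier A\<rbrakk>
      \<Longrightarrow> ((x \<squnion> y) \<box>\<rightarrow> x) \<squnion> ((x \<squnion> y) \<box>\<rightarrow> y) \<squnion>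
            (((x \<squnion> y) \<box>\<rightarrow> z) \<Leftrightarrow> ((x \<box>\<rightarrow> z) \<sqinter> (y \<box>\<rightarrow> z))) = \<one>"
    and cond_meet: "\<lbrakk>x \<in> carrier A; y \<in> carrier A; z \<in> carrier A\<rbrakk>
      \<Longrightarrow> x \<box>\<rightarrow> (y \<sqinter> z) = (x \<box>\<rightarrow> y) \<sqinter> (x \<box>\<rightarrow> z)"

text \<open>The class of V-algebras carried by subsets of \<open>'a\<close>. HOL does not quantify over types inside a
  formula; as the language is countable, equational consequence over this class agrees with
  consequence over all V-algebras as soon as \<open>'a\<close> is infinite.\<close>

definition V_algebras :: "'a alg set" where
  "V_algebras = {A. V_algebra A}"


section \<open>Equational consequence and varieties\<close>

primrec eval :: "'a alg \<Rightarrow> (nat \<Rightarrow> 'a) \<Rightarrow> fm \<Rightarrow> 'a" where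
  "eval A h (Var n) = h n"
| "eval A h \<^bold>0 = \<zero>\<^bsub>A\<^esub>"
| "eval A h \<^bold>1 = \<one>\<^bsub>A\<^esub>"
| "eval A h (\<phi> \<^bold>\<and> \<psi>) = eval A h \<phi> \<sqinter>\<^bsub>A\<^esub> eval A h \<psi>"
| "eval A h (\<phi> \<^bold>\<or> \<psi>) = eval A h \<phi> \<squnion>\<^bsub>A\<^esub> eval A h \<psi>"
| "eval A h (\<phi> \<^bold>\<rightarrow> \<psi>) = eval A h \<phi> \<Rightarrow>\<^bsub>A\<^esub> eval A h \<psi>"
| "eval A h (\<phi> \<^bold>\<box>\<rightarrow> \<psi>) = eval A h \<phi> \<box>\<rightarrow>\<^bsub>A\<^esub> eval A h \<psi>"

text \<open>Formulas double as terms; the pair \<open>(s, t)\<close> is the equation \<open>s \<approx> t\<close>.\<close>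

type_synonym equation = "fm \<times> fm"

definition satisfies :: "'a alg \<Rightarrow> (nat \<Rightarrow> 'a) \<Rightarrow> equation \<Rightarrow> bool" where
  "satisfies A h e \<longleftrightarrow> eval A h (fst e) = eval A h (snd e)"

definition eq_conseq :: "'a alg set \<Rightarrow> equation set \<Rightarrow> equation set \<Rightarrow> bool" where
  "eq_conseq K E F \<longleftrightarrow>
     (\<forall>A\<in>K. \<forall>h. range h \<subseteq> carrier A \<longrightarrow>
        (\<forall>e\<in>E. satisfies A h e) \<longrightarrow> (\<forall>e\<in>F. satisfies A h e))"

definition variety :: "'a alg set \<Rightarrow> bool" where
  "variety K \<longleftrightarrow>
     (\<exists>E. K = {A. algebra A \<and> (\<forall>h. range h \<subseteq> carrier A \<longrightarrow> (\<forall>e\<in>E. satisfies A h e))})"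


section \<open>Equivalent algebraic semantics\<close>

text \<open>A set \<open>\<tau>\<close> of equations in the single variable \<open>Var 0\<close> and a set \<open>\<Delta>\<close> of formulas in the
  variables \<open>Var 0\<close> and \<open>Var 1\<close> are instantiated by substitution.\<close>

definition tau_inst :: "equation set \<Rightarrow> fm set \<Rightarrow> equation set" where
  "tau_inst \<tau> \<Gamma> = {(subst (\<lambda>_. \<gamma>) s, subst (\<lambda>_. \<gamma>) t) | \<gamma> s t. \<gamma> \<in> \<Gamma> \<and> (s, t) \<in> \<tau>}"

definition Delta_inst :: "fm set \<Rightarrow> fm \<Rightarrow> fm \<Rightarrow> fm set" where
  "Delta_inst \<Delta> \<phi> \<psi> = {subst (\<lambda>n. if n = 0 then \<phi> else \<psi>) \<delta> | \<delta>. \<delta> \<in> \<Delta>}"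

definition equivalent_algebraic_semantics_via ::
    "conseq \<Rightarrow> 'a alg set \<Rightarrow> equation set \<Rightarrow> fm set \<Rightarrow> bool" where
  "equivalent_algebraic_semantics_via L K \<tau> \<Delta> \<longleftrightarrow>
     finite \<tau> \<and> (\<forall>(s, t)\<in>\<tau>. vars s \<union> vars t \<subseteq> {0}) \<and>
     finite \<Delta> \<and> (\<forall>\<delta>\<in>\<Delta>. vars \<delta> \<subseteq> {0, 1}) \<and>
     (\<forall>\<Gamma> \<phi>. L \<Gamma> \<phi> \<longleftrightarrow> eq_conseq K (tau_inst \<tau> \<Gamma>) (tau_inst \<tau> {\<phi>})) \<and>
     eq_conseq K {(Var 0, Var 1)} (tau_inst \<tau> (Delta_inst \<Delta> (Var 0) (Var 1))) \<and>
     eq_conseq K (tau_inst \<tau> (Delta_inst \<Delta> (Var 0) (Var 1))) {(Var 0, Var 1)}"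

definition equivalent_algebraic_semantics :: "conseq \<Rightarrow> 'a alg set \<Rightarrow> bool" where
  "equivalent_algebraic_semantics L K \<longleftrightarrow>
     (\<exists>\<tau> \<Delta>. equivalent_algebraic_semantics_via L K \<tau> \<Delta>)"

end

theory Submission
  imports Defs "HOL-Library.Countable"
begin

text \<open>Soundness is an induction on derivations. Completeness uses the Lindenbaum algebra of a theory
  \<open>\<Gamma>\<close>: rule (C) makes provable equivalence a congruence in the second argument of the
  conditional, and (C) with (L1) turns \<open>\<phi> \<leftrightarrow> \<psi>\<close> into the antecedent of (L2), which gives the
  congruence in the first argument. The algebra is countable, so it can be carried by a subset
  of any infinite type.\<close>

section \<open>Order in Boolean algebras\<close>

context boolean_alg
begin

lemmas closed = zero_closed one_closed meet_closed join_closed impl_closed cond_closed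

lemma meet_idem: "x \<in> carrier A \<Longrightarrow> x \<sqinter> x = x"
  by (metis join_zero meet_absorb zero_closed)

lemma leq_refl: "x \<in> carrier A \<Longrightarrow> x \<sqsubseteq> x"
  by (simp add: leq_def meet_idem)

lemma leq_trans:
  "\<lbrakk>x \<sqsubseteq> y; y \<sqsubseteq> z; x \<in> carrier A; y \<in> carrier A; z \<in> carrier A\<rbrakk> \<Longrightarrow> x \<sqsubseteq> z"
  unfolding leq_def by (metis meet_assoc)

lemma leq_antisym: "\<lbrakk>x \<sqsubseteq> y; y \<sqsubseteq> x; x \<in> carrier A; y \<in> carrier A\<rbrakk> \<Longrightarrow> x = y"
  unfolding leq_def by (metis meet_commute)

lemma leq_iff_join: "x \<in> carrier A \<Longrightarrow> y \<in> carrier A \<Longrightarrow> x \<sqsubseteq> y \<longleftrightarrow> x \<squnion> y = y"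
  unfolding leq_def by (metis meet_absorb join_absorb meet_commute join_commute)

lemma meet_leq1: "x \<in> carrier A \<Longrightarrow> y \<in> carrier A \<Longrightarrow> x \<sqinter> y \<sqsubseteq> x"
  unfolding leq_def by (metis meet_assoc meet_commute meet_idem)

lemma meet_leq2: "x \<in> carrier A \<Longrightarrow> y \<in> carrier A \<Longrightarrow> x \<sqinter> y \<sqsubseteq> y"
  unfolding leq_def by (metis meet_assoc meet_idem)

lemma leq_meet:
  "\<lbrakk>z \<sqsubseteq> x; z \<sqsubseteq> y; x \<in> carrier A; y \<in> carrier A; z \<in> carrier A\<rbrakk> \<Longrightarrow> z \<sqsubseteq> x \<sqinter> y"
  unfolding leq_def by (metis meet_assoc)

lemma leq_join1: "x \<in> carrier A \<Longrightarrow> y \<in> carrier A \<Longrightarrow> x \<sqsubseteq> x \<squnion> y"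
  unfolding leq_def by (rule meet_absorb)

lemma leq_join2: "x \<in> carrier A \<Longrightarrow> y \<in> carrier A \<Longrightarrow> y \<sqsubseteq> x \<squnion> y"
  by (metis leq_join1 join_commute)

lemma join_leq:
  "\<lbrakk>x \<sqsubseteq> z; y \<sqsubseteq> z; x \<in> carrier A; y \<in> carrier A; z \<in> carrier A\<rbrakk> \<Longrightarrow> x \<squnion> y \<sqsubseteq> z"
  by (metis leq_iff_join join_assoc join_closed)

lemma leq_one: "x \<in> carrier A \<Longrightarrow> x \<sqsubseteq> \<one>"
  unfolding leq_def by (rule meet_one)

lemma zero_leq: "x \<in> carrier A \<Longrightarrow> \<zero> \<sqsubseteq> x"
  by (metis leq_iff_join join_commute join_zero zero_closed)

text \<open>Residuation follows from distributivity and complements: meeting with y removes the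
  complement of y, and conversely x is split along y and its complement. It lets nested implications
  be checked as inequalities between meets.\<close>

lemma leq_impl_iff:
  assumes x: "x \<in> carrier A" and y: "y \<in> carrier A" and z: "z \<in> carrier A"
  shows "x \<sqsubseteq> (y \<Rightarrow> z) \<longleftrightarrow> x \<sqinter> y \<sqsubseteq> z"
proof
  let ?n = "y \<Rightarrow> \<zero>"
  have n: "?n \<in> carrier A" using y by (simp add: closed)
  show "x \<sqinter> y \<sqsubseteq> z" if le: "x \<sqsubseteq> (y \<Rightarrow> z)"
  proof -
    have "x \<sqinter> y \<sqsubseteq> (?n \<squnion> z) \<sqinter> y"
      using le x y z n impl_eq[OF y z] meet_leq1[OF x y] meet_leq2[OF x y]
      by (intro leq_meet) (auto intro: leq_trans simp: closed)
    also have "(?n \<squnion> z) \<sqinter> y = (y \<sqinter> ?n) \<squnion> (y \<sqinter> z)"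
      using y z n by (metis meet_commute meet_distrib join_closed)
    also have "\<dots> = y \<sqinter> z"
      using y z by (metis meet_compl join_commute join_zero meet_closed zero_closed)
    finally show ?thesis
      using x y z meet_leq2[OF y z] by (auto intro: leq_trans simp: closed)
  qed
  show "x \<sqsubseteq> (y \<Rightarrow> z)" if le: "x \<sqinter> y \<sqsubseteq> z"
  proof -
    have "x = x \<sqinter> (y \<squnion> ?n)" using x y by (simp add: join_compl meet_one)
    also have "\<dots> = (x \<sqinter> y) \<squnion> (x \<sqinter> ?n)" using x y n by (simp add: meet_distrib)
    also have "\<dots> \<sqsubseteq> ?n \<squnion> z"
      using le x y z n meet_leq2[OF x n] leq_join1[OF n z] leq_join2[OF n z]
      by (intro join_leq) (auto intro: leq_trans simp: closed)
    finally show ?thesis using y z by (simp add: impl_eq[of y z])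
  qed
qed

lemma one_leq_iff: "x \<in> carrier A \<Longrightarrow> \<one> \<sqsubseteq> x \<longleftrightarrow> x = \<one>"
  by (metis leq_antisym leq_one leq_refl one_closed)

lemma impl_eq_one_iff:
  assumes "x \<in> carrier A" "y \<in> carrier A"
  shows "x \<Rightarrow> y = \<one> \<longleftrightarrow> x \<sqsubseteq> y"
proof -
  have "x \<Rightarrow> y = \<one> \<longleftrightarrow> \<one> \<sqsubseteq> (x \<Rightarrow> y)" using assms by (simp add: one_leq_iff closed)
  also have "\<dots> \<longleftrightarrow> \<one> \<sqinter> x \<sqsubseteq> y" using assms by (simp add: leq_impl_iff closed)
  also have "\<one> \<sqinter> x = x" using assms by (metis meet_commute meet_one one_closed)
  finally show ?thesis .
qed

lemma meet_eq_one_iff: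
  "x \<in> carrier A \<Longrightarrow> y \<in> carrier A \<Longrightarrow> x \<sqinter> y = \<one> \<longleftrightarrow> x = \<one> \<and> y = \<one>"
  by (metis one_leq_iff meet_leq1 meet_leq2 meet_one one_closed)

text \<open>By antisymmetry. This is the semantic reason why the biconditional can serve as
  equivalence formula and \<open>x = \<one>\<close> as defining equation.\<close>

lemma biimpl_eq_one_iff:
  "x \<in> carrier A \<Longrightarrow> y \<in> carrier A \<Longrightarrow> x \<Leftrightarrow> y = \<one> \<longleftrightarrow> x = y"
  unfolding biimpl_def
  by (metis meet_eq_one_iff impl_eq_one_iff impl_closed leq_antisym leq_refl)

text \<open>Split the double complement along x and its complement; the second part
  vanishes.\<close>

lemma double_compl_leq:
  assumes x: "x \<in> carrier A"
  shows "((x \<Rightarrow> \<zero>) \<Rightarrow> \<zero>) \<sqsubseteq> x"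
proof -
  let ?n = "x \<Rightarrow> \<zero>"
  let ?m = "?n \<Rightarrow> \<zero>"
  have c: "?n \<in> carrier A" "?m \<in> carrier A" using x by (auto simp: closed)
  have "?m = ?m \<sqinter> (x \<squnion> ?n)" using x c by (simp add: join_compl meet_one)
  also have "\<dots> = (?m \<sqinter> x) \<squnion> (?m \<sqinter> ?n)" using x c by (simp add: meet_distrib)
  also have "?m \<sqinter> ?n = \<zero>" using c by (metis meet_commute meet_compl)
  finally have "?m = ?m \<sqinter> x" using x c by (simp add: join_zero closed)
  then show ?thesis by (simp add: leq_def)
qed

section \<open>Validity of the classical axioms\<close>

lemma eval_closed: "range h \<subseteq> carrier A \<Longrightarrow> eval A h \<phi> \<in> carrier A"
  by (induction \<phi>) (auto simp: closed)

lemma eval_classical_axioms: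
  assumes "\<phi> \<in> classical_axioms" and h: "range h \<subseteq> carrier A"
  shows "eval A h \<phi> = \<one>"
proof -
  note e = eval_closed[OF h]
  show ?thesis
    using assms(1)
  proof (induction rule: classical_axioms.induct)
    case (1 \<phi> \<psi>)
    show ?case by (simp add: e closed impl_eq_one_iff leq_impl_iff meet_leq1)
  next
    case (2 \<phi> \<psi> \<gamma>)
    let ?x = "eval A h \<phi>" and ?y = "eval A h \<psi>" and ?z = "eval A h \<gamma>"
    let ?c = "((?x \<Rightarrow> ?y \<Rightarrow> ?z) \<sqinter> (?x \<Rightarrow> ?y)) \<sqinter> ?x"
    have c: "?c \<in> carrier A" by (simp add: e closed)
    have cx: "?c \<sqsubseteq> ?x" by (simp add: e closed meet_leq2)
    have "?c \<sqsubseteq> (?x \<Rightarrow> ?y \<Rightarrow> ?z) \<sqinter> (?x \<Rightarrow> ?y)" by (simp add: e closed meet_leq1)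
    then have c1: "?c \<sqsubseteq> (?x \<Rightarrow> ?y \<Rightarrow> ?z)" and c2: "?c \<sqsubseteq> (?x \<Rightarrow> ?y)"
      by (rule leq_trans; simp add: e closed meet_leq1 meet_leq2)+
    \<comment> \<open>Modus ponens below the fixed element \<open>?c\<close>. Residuating the axiom
      puts both premises and \<open>?x\<close> above \<open>?c\<close>; three detachments then reach
      \<open>?z\<close>.\<close>
    have detach: "?c \<sqsubseteq> v" if "?c \<sqsubseteq> (u \<Rightarrow> v)" "?c \<sqsubseteq> u" "u \<in> carrier A" "v \<in> carrier A" for u v
    proof -
      have "?c \<sqinter> u \<sqsubseteq> v" using that c by (simp add: leq_impl_iff)
      then show ?thesis using that(2) by (simp add: leq_def)
    qed
    have "?c \<sqsubseteq> ?z"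
      using detach[OF detach[OF c1 cx] detach[OF c2 cx]] by (simp add: e closed)
    then show ?case by (simp add: e closed impl_eq_one_iff leq_impl_iff)
  next
    case (3 \<phi> \<psi>)
    show ?case by (simp add: e closed impl_eq_one_iff meet_leq1)
  next
    case (4 \<phi> \<psi>)
    show ?case by (simp add: e closed impl_eq_one_iff meet_leq2)
  next
    case (5 \<phi> \<psi>)
    show ?case by (simp add: e closed impl_eq_one_iff leq_impl_iff leq_refl)
  next
    case (6 \<phi> \<psi>)
    show ?case by (simp add: e closed impl_eq_one_iff leq_join1)
  next
    case (7 \<psi> \<phi>)
    show ?case by (simp add: e closed impl_eq_one_iff leq_join2)
  next
    case (8 \<phi> \<gamma> \<psi>)
    let ?x = "eval A h \<phi>" and ?y = "eval A h \<psi>" and ?z = "eval A h \<gamma>"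
    let ?c = "(?x \<Rightarrow> ?z) \<sqinter> (?y \<Rightarrow> ?z)"
    have c: "?c \<in> carrier A" by (simp add: e closed)
    have "?c \<sqinter> ?x \<sqsubseteq> ?z" "?c \<sqinter> ?y \<sqsubseteq> ?z"
      using meet_leq1[of "?x \<Rightarrow> ?z" "?y \<Rightarrow> ?z"] meet_leq2[of "?x \<Rightarrow> ?z" "?y \<Rightarrow> ?z"] c
      by (simp_all add: e closed flip: leq_impl_iff)
    \<comment> \<open>Distributivity splits the join into the two cases just proved.\<close>
    then have "?c \<sqinter> (?x \<squnion> ?y) \<sqsubseteq> ?z"
      using c by (simp add: meet_distrib e closed join_leq)
    then show ?case by (simp add: e closed impl_eq_one_iff leq_impl_iff)
  next
    case (9 \<phi>)
    show ?case by (simp add: e closed impl_eq_one_iff zero_leq)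
  next
    case 10
    show ?case by simp
  next
    case (11 \<phi>)
    show ?case by (simp add: e closed impl_eq_one_iff double_compl_leq)
  qed
qed

end

section \<open>Soundness\<close>

context V_algebra
begin

text \<open>Axiom (4) makes the conditional preserve meets in its second argument, hence order. This
  is the semantic form of rule (C).\<close>

lemma cond_mono:
  "\<lbrakk>x \<sqsubseteq> y; x \<in> carrier A; y \<in> carrier A; z \<in> carrier A\<rbrakk> \<Longrightarrow> (z \<box>\<rightarrow> x) \<sqsubseteq> (z \<box>\<rightarrow> y)"
  unfolding leq_def by (metis cond_meet)

lemma eval_lewis_axioms:
  assumes "\<phi> \<in> lewis_axioms" and h: "range h \<subseteq> carrier A"
  shows "eval A h \<phi> = \<one>"
proof -
  note e = eval_closed[OF h]
  show ?thesis
    using assms(1)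
  proof (induction rule: lewis_axioms.induct)
    case (L1 \<phi>)
    show ?case by (simp add: e cond_refl)
  next
    case (L2 \<phi> \<psi> \<gamma>)
    show ?case
      using cond_cong[OF e[of \<phi>] e[of \<psi>] e[of \<gamma>]]
      by (simp add: e closed impl_eq_one_iff biimpl_def)
  next
    case (L3 \<phi> \<psi> \<gamma>)
    \<comment> \<open>Disjunction of formulas associates to the right, the join of the algebra to
      the left; \<open>join_assoc\<close> bridges the two forms of (L3).\<close>
    show ?case
      using cond_join[OF e[of \<phi>] e[of \<psi>] e[of \<gamma>]]
      by (simp add: e closed join_assoc biimpl_def)
  next
    case (L4 \<phi> \<psi> \<gamma>)
    show ?case
      by (simp add: e closed cond_meet impl_eq_one_iff meet_eq_one_iff leq_refl)
  qed
qed

text \<open>A single valuation can be fixed throughout: an implication of value one is an inequality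
  in the algebra, so \<open>cond_mono\<close> validates (C) under that same valuation.\<close>

lemma derivable_sound:
  assumes "derivable \<Gamma> \<phi>" and h: "range h \<subseteq> carrier A" and "\<forall>\<gamma>\<in>\<Gamma>. eval A h \<gamma> = \<one>"
  shows "eval A h \<phi> = \<one>"
proof -
  note e = eval_closed[OF h]
  show ?thesis
    using assms(1)
  proof (induction rule: derivable.induct)
    case (hyp \<phi>)
    then show ?case using assms(3) by blast
  next
    case (ax \<phi>)
    then show ?case using eval_classical_axioms eval_lewis_axioms h by blast
  next
    case (mp \<phi> \<psi>)
    then show ?case by (simp add: e closed impl_eq_one_iff one_leq_iff)
  next
    case (C \<phi> \<psi> \<gamma>)
    then show ?case by (simp add: e closed impl_eq_one_iff cond_mono)
  qed
qed

end

section \<open>The provability preorder\<close>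

context
  fixes \<Gamma> :: "fm set"
begin

text \<open>Assumptions are kept to the left of an implication instead of being added to \<Gamma>,
  since rule (C) destroys the usual deduction theorem.\<close>

abbreviation entails :: "fm \<Rightarrow> fm \<Rightarrow> bool"  (infix \<open>\<preceq>\<close> 50) where
  "\<phi> \<preceq> \<psi> \<equiv> derivable \<Gamma> (\<phi> \<^bold>\<rightarrow> \<psi>)"

lemma derivable_classical: "\<phi> \<in> classical_axioms \<Longrightarrow> derivable \<Gamma> \<phi>"
  by (simp add: derivable.ax)

lemma derivable_lewis: "\<phi> \<in> lewis_axioms \<Longrightarrow> derivable \<Gamma> \<phi>"
  by (simp add: derivable.ax)

lemmas classical = classical_axioms.intros[THEN derivable_classical]

lemma entails_const: "derivable \<Gamma> \<psi> \<Longrightarrow> \<phi> \<preceq> \<psi>"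
  using classical(1) derivable.mp by blast

lemma entails_detach: "\<phi> \<preceq> \<psi> \<^bold>\<rightarrow> \<gamma> \<Longrightarrow> \<phi> \<preceq> \<psi> \<Longrightarrow> \<phi> \<preceq> \<gamma>"
  using classical(2) derivable.mp by blast

lemma entails_refl: "\<phi> \<preceq> \<phi>"
  using classical(1) entails_detach by blast

lemma entails_trans [trans]: "\<phi> \<preceq> \<psi> \<Longrightarrow> \<psi> \<preceq> \<gamma> \<Longrightarrow> \<phi> \<preceq> \<gamma>"
  using entails_const entails_detach by blast

lemma entails_Con: "\<phi> \<preceq> \<psi> \<Longrightarrow> \<phi> \<preceq> \<gamma> \<Longrightarrow> \<phi> \<preceq> \<psi> \<^bold>\<and> \<gamma>"
  using classical(5) entails_trans entails_detach by blast

lemma Con_entails: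
  shows "\<phi> \<preceq> \<gamma> \<Longrightarrow> \<phi> \<^bold>\<and> \<psi> \<preceq> \<gamma>" and "\<psi> \<preceq> \<gamma> \<Longrightarrow> \<phi> \<^bold>\<and> \<psi> \<preceq> \<gamma>"
  using classical(3,4) entails_trans by blast+

lemma entails_Dis:
  shows "\<gamma> \<preceq> \<phi> \<Longrightarrow> \<gamma> \<preceq> \<phi> \<^bold>\<or> \<psi>" and "\<gamma> \<preceq> \<psi> \<Longrightarrow> \<gamma> \<preceq> \<phi> \<^bold>\<or> \<psi>"
  using classical(6,7) entails_trans by blast+

lemma Dis_entails: "\<phi> \<preceq> \<gamma> \<Longrightarrow> \<psi> \<preceq> \<gamma> \<Longrightarrow> \<phi> \<^bold>\<or> \<psi> \<preceq> \<gamma>"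
  using classical(8) derivable.mp by blast

text \<open>Syntactic residuation, standing in for the deduction theorem. From right to left, the
  implication is weakened by \<psi> and distributed by the second axiom, giving (\<psi>
  \<rightarrow> \<phi> \<and> \<psi>) \<rightarrow> (\<psi> \<rightarrow> \<gamma>), whose
  antecedent follows from \<phi>.\<close>

lemma entails_Imp_iff: "\<phi> \<preceq> \<psi> \<^bold>\<rightarrow> \<gamma> \<longleftrightarrow> \<phi> \<^bold>\<and> \<psi> \<preceq> \<gamma>"
proof
  show "\<phi> \<^bold>\<and> \<psi> \<preceq> \<gamma>" if "\<phi> \<preceq> \<psi> \<^bold>\<rightarrow> \<gamma>"
    using that entails_refl Con_entails entails_detach by meson
  show "\<phi> \<preceq> \<psi> \<^bold>\<rightarrow> \<gamma>" if "\<phi> \<^bold>\<and> \<psi> \<preceq> \<gamma>"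
    using derivable.mp[OF entails_const[OF that] classical(2)] classical(5) entails_trans by blast
qed

lemma Con_swap: "\<psi> \<^bold>\<and> \<phi> \<preceq> \<gamma> \<Longrightarrow> \<phi> \<^bold>\<and> \<psi> \<preceq> \<gamma>"
  by (rule entails_trans[rotated], assumption) (intro entails_Con Con_entails entails_refl)

text \<open>Distributivity as an elimination rule: residuation moves \<gamma> to the right, where
  the disjunction can be eliminated.\<close>

lemma Con_Dis_entails: "\<gamma> \<^bold>\<and> \<phi> \<preceq> \<chi> \<Longrightarrow> \<gamma> \<^bold>\<and> \<psi> \<preceq> \<chi> \<Longrightarrow> \<gamma> \<^bold>\<and> (\<phi> \<^bold>\<or> \<psi>) \<preceq> \<chi>"
  by (meson Con_swap Dis_entails entails_Imp_iff)

lemma Dis_Con_entails: "\<phi> \<^bold>\<and> \<gamma> \<preceq> \<chi> \<Longrightarrow> \<psi> \<^bold>\<and> \<gamma> \<preceq> \<chi> \<Longrightarrow> (\<phi> \<^bold>\<or> \<psi>) \<^bold>\<and> \<gamma> \<preceq> \<chi>"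
  by (meson Dis_entails entails_Imp_iff)

lemma Imp_entails: "(\<phi> \<^bold>\<rightarrow> \<psi>) \<^bold>\<and> \<phi> \<preceq> \<psi>" "\<phi> \<^bold>\<and> (\<phi> \<^bold>\<rightarrow> \<psi>) \<preceq> \<psi>"
  using entails_Imp_iff entails_refl Con_swap by blast+

text \<open>The negation of \<open>?e\<close> refutes \<phi>, hence yields the second disjunct and
  so \<open>?e\<close> itself, a contradiction; double negation elimination finishes.\<close>

lemma derivable_excluded_middle: "derivable \<Gamma> (\<phi> \<^bold>\<or> (\<phi> \<^bold>\<rightarrow> \<^bold>0))"
proof -
  let ?e = "\<phi> \<^bold>\<or> (\<phi> \<^bold>\<rightarrow> \<^bold>0)"
  have "(?e \<^bold>\<rightarrow> \<^bold>0) \<^bold>\<and> \<phi> \<preceq> \<^bold>0"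
    using entails_detach[of _ ?e "\<^bold>0"] Con_entails entails_Dis entails_refl by meson
  then have "?e \<^bold>\<rightarrow> \<^bold>0 \<preceq> ?e" by (simp add: entails_Imp_iff entails_Dis)
  then have "?e \<^bold>\<rightarrow> \<^bold>0 \<preceq> \<^bold>0" using entails_detach entails_refl by blast
  then show ?thesis using classical(11) derivable.mp by blast
qed

lemma derivable_Con_iff: "derivable \<Gamma> (\<phi> \<^bold>\<and> \<psi>) \<longleftrightarrow> derivable \<Gamma> \<phi> \<and> derivable \<Gamma> \<psi>"
  by (meson classical(3,4,5) derivable.mp)

lemma derivable_iff_Iff_Tru: "derivable \<Gamma> (\<phi> \<^bold>\<leftrightarrow> \<^bold>1) \<longleftrightarrow> derivable \<Gamma> \<phi>"
  by (meson classical(10) derivable_Con_iff entails_const derivable.mp)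

lemma entails_imp_derivable_Cnd: "\<phi> \<preceq> \<psi> \<Longrightarrow> derivable \<Gamma> (\<phi> \<^bold>\<box>\<rightarrow> \<psi>)"
  by (rule derivable.mp[OF derivable_lewis[OF lewis_axioms.L1] derivable.C])

lemma Cnd_entails_cong1:
  assumes "\<phi> \<preceq> \<psi>" "\<psi> \<preceq> \<phi>"
  shows "\<phi> \<^bold>\<box>\<rightarrow> \<gamma> \<preceq> \<psi> \<^bold>\<box>\<rightarrow> \<gamma>"
proof -
  have "derivable \<Gamma> ((\<phi> \<^bold>\<box>\<rightarrow> \<psi>) \<^bold>\<and> (\<psi> \<^bold>\<box>\<rightarrow> \<phi>))"
    using assms by (simp add: derivable_Con_iff entails_imp_derivable_Cnd)
  then have "derivable \<Gamma> ((\<phi> \<^bold>\<box>\<rightarrow> \<gamma>) \<^bold>\<leftrightarrow> (\<psi> \<^bold>\<box>\<rightarrow> \<gamma>))"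
    by (rule derivable.mp[OF _ derivable_lewis[OF lewis_axioms.L2]])
  then show ?thesis by (simp add: derivable_Con_iff)
qed

text \<open>The conditional is monotone only in its consequent, so the antecedents must entail each
  other.\<close>

lemma Cnd_entails:
  "\<phi> \<preceq> \<phi>' \<Longrightarrow> \<phi>' \<preceq> \<phi> \<Longrightarrow> \<psi> \<preceq> \<psi>' \<Longrightarrow> \<phi> \<^bold>\<box>\<rightarrow> \<psi> \<preceq> \<phi>' \<^bold>\<box>\<rightarrow> \<psi>'"
  by (rule entails_trans[OF Cnd_entails_cong1 derivable.C])

lemma Con_mono: "\<phi> \<preceq> \<phi>' \<Longrightarrow> \<psi> \<preceq> \<psi>' \<Longrightarrow> \<phi> \<^bold>\<and> \<psi> \<preceq> \<phi>' \<^bold>\<and> \<psi>'"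
  by (simp add: entails_Con Con_entails)

lemma Dis_mono: "\<phi> \<preceq> \<phi>' \<Longrightarrow> \<psi> \<preceq> \<psi>' \<Longrightarrow> \<phi> \<^bold>\<or> \<psi> \<preceq> \<phi>' \<^bold>\<or> \<psi>'"
  by (simp add: Dis_entails entails_Dis)

lemma Imp_mono:
  assumes "\<phi>' \<preceq> \<phi>" "\<psi> \<preceq> \<psi>'"
  shows "\<phi> \<^bold>\<rightarrow> \<psi> \<preceq> \<phi>' \<^bold>\<rightarrow> \<psi>'"
  unfolding entails_Imp_iff
  by (rule entails_trans[OF _ assms(2)], rule entails_detach[of _ \<phi>])
    (intro Con_entails entails_refl assms)+

end

section \<open>The Lindenbaum algebra\<close>

text \<open>The map \<open>g\<close> labels formulas by elements of \<open>'a\<close>; it will identify exactly the provably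
  equivalent ones, so that its range is a copy of the quotient.\<close>

definition lindenbaum :: "(fm \<Rightarrow> 'a) \<Rightarrow> 'a alg" where
  "lindenbaum g = \<lparr>carrier = range g,
     meet = (\<lambda>x y. g (inv g x \<^bold>\<and> inv g y)),
     join = (\<lambda>x y. g (inv g x \<^bold>\<or> inv g y)),
     impl = (\<lambda>x y. g (inv g x \<^bold>\<rightarrow> inv g y)),
     cond = (\<lambda>x y. g (inv g x \<^bold>\<box>\<rightarrow> inv g y)),
     zero = g \<^bold>0,
     one = g \<^bold>1\<rparr>"

text \<open>Only the kernel of \<open>g\<close> is prescribed, which separates the algebra of the
  quotient from the question of how it embeds into the type.\<close>

locale lindenbaum_labelling =
  fixes \<Gamma> :: "fm set" and g :: "fm \<Rightarrow> 'a"
  assumes label_eq_derivable: "g \<phi> = g \<psi> \<longleftrightarrow> derivable \<Gamma> (\<phi> \<^bold>\<leftrightarrow> \<psi>)"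
begin

lemma label_eq_iff:
  "g \<phi> = g \<psi> \<longleftrightarrow> derivable \<Gamma> (\<phi> \<^bold>\<rightarrow> \<psi>) \<and> derivable \<Gamma> (\<psi> \<^bold>\<rightarrow> \<phi>)"
  by (simp add: label_eq_derivable derivable_Con_iff)

lemma label_eq_Tru_iff: "g \<phi> = g \<^bold>1 \<longleftrightarrow> derivable \<Gamma> \<phi>"
  by (simp only: label_eq_derivable derivable_iff_Iff_Tru)

lemma label_inv:
  "derivable \<Gamma> (inv g (g \<phi>) \<^bold>\<rightarrow> \<phi>)" "derivable \<Gamma> (\<phi> \<^bold>\<rightarrow> inv g (g \<phi>))"
  using f_inv_into_f[of "g \<phi>" g UNIV] label_eq_iff[of "inv g (g \<phi>)" \<phi>] by simp_all

text \<open>The operations are independent of the representatives chosen by \<open>inv g\<close>: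
  these are provably equivalent to the original formulas, and every connective respects that
  equivalence.\<close>

lemma lindenbaum_simps [simp]:
  "carrier (lindenbaum g) = range g"
  "meet (lindenbaum g) (g \<phi>) (g \<psi>) = g (\<phi> \<^bold>\<and> \<psi>)"
  "join (lindenbaum g) (g \<phi>) (g \<psi>) = g (\<phi> \<^bold>\<or> \<psi>)"
  "impl (lindenbaum g) (g \<phi>) (g \<psi>) = g (\<phi> \<^bold>\<rightarrow> \<psi>)"
  "cond (lindenbaum g) (g \<phi>) (g \<psi>) = g (\<phi> \<^bold>\<box>\<rightarrow> \<psi>)"
  "zero (lindenbaum g) = g \<^bold>0"
  "one (lindenbaum g) = g \<^bold>1"
  by (simp_all add: lindenbaum_def label_eq_iff label_inv Con_mono Dis_mono Imp_mono Cnd_entails)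

text \<open>Under the canonical valuation each formula denotes its own class, so having value one
  means being derivable from \<Gamma>.\<close>

lemma eval_lindenbaum: "eval (lindenbaum g) (g \<circ> Var) \<phi> = g \<phi>"
  by (induction \<phi>) simp_all

lemma boolean_alg_lindenbaum: "boolean_alg (lindenbaum g)"
proof -
  have Imp_iff: "g (\<phi> \<^bold>\<rightarrow> \<psi>) = g ((\<phi> \<^bold>\<rightarrow> \<^bold>0) \<^bold>\<or> \<psi>)" for \<phi> \<psi>
  proof -
    let ?i = "\<phi> \<^bold>\<rightarrow> \<psi>" and ?n = "\<phi> \<^bold>\<rightarrow> \<^bold>0"
    \<comment> \<open>Case distinction on \<phi>: with \<phi> the implication gives \<psi>,
      otherwise \<open>?n\<close> is at hand. The excluded middle is then detached.\<close>
    have "derivable \<Gamma> (?i \<^bold>\<and> (\<phi> \<^bold>\<or> ?n) \<^bold>\<rightarrow> ?n \<^bold>\<or> \<psi>)"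
      by (simp add: Con_Dis_entails entails_Dis Imp_entails Con_entails entails_refl)
    then have "derivable \<Gamma> (?i \<^bold>\<rightarrow> ?n \<^bold>\<or> \<psi>)"
      using entails_detach entails_const[OF derivable_excluded_middle] entails_Imp_iff by blast
    moreover have "derivable \<Gamma> (?n \<^bold>\<or> \<psi> \<^bold>\<rightarrow> ?i)"
      using Dis_entails Imp_mono[OF entails_refl classical(9)] classical(1) by blast
    ultimately show ?thesis by (simp add: label_eq_iff)
  qed
  have em: "g (\<phi> \<^bold>\<or> (\<phi> \<^bold>\<rightarrow> \<^bold>0)) = g \<^bold>1" for \<phi>
    by (simp add: label_eq_Tru_iff derivable_excluded_middle)
  note lattice = entails_refl Con_entails entails_Con Dis_entails entails_Dis
    Con_Dis_entails Dis_Con_entails Imp_entails classical(9) entails_const[OF classical(10)]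
  \<comment> \<open>Apart from closure and the two facts above, each law is an equality of labels,
    which is proved as a pair of entailments.\<close>
  show ?thesis
    by unfold_locales (auto simp: em intro: Imp_iff, (simp add: label_eq_iff lattice)+)
qed

lemma V_algebra_lindenbaum: "V_algebra (lindenbaum g)"
proof -
  interpret boolean_alg "lindenbaum g" by (rule boolean_alg_lindenbaum)
  note lewis = lewis_axioms.intros[THEN derivable_lewis]
  have biimpl [simp]: "biimpl (g \<phi>) (g \<psi>) = g (\<phi> \<^bold>\<leftrightarrow> \<psi>)" for \<phi> \<psi>
    by (simp add: biimpl_def)
  \<comment> \<open>The order of the quotient is derivable implication, which turns axiom (2) into
    (L2).\<close>
  have leq [simp]: "leq (g \<phi>) (g \<psi>) \<longleftrightarrow> derivable \<Gamma> (\<phi> \<^bold>\<rightarrow> \<psi>)" for \<phi> \<psi>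
    using impl_eq_one_iff[of "g \<phi>" "g \<psi>"] by (simp add: label_eq_Tru_iff)
  show ?thesis
  proof (unfold_locales, goal_cases)
    case (1 x)
    then show ?case by (auto simp: label_eq_Tru_iff lewis)
  next
    case (2 x y z)
    then show ?case by (auto simp: lewis)
  next
    case (3 x y z)
    then obtain a b c where [simp]: "x = g a" "y = g b" "z = g c" by auto
    \<comment> \<open>As in the soundness proof, (L3) has to be reassociated to match axiom
      (3).\<close>
    show ?case
      using lewis(3)[of \<Gamma> a b c] join_assoc[of "g ((a \<^bold>\<or> b) \<^bold>\<box>\<rightarrow> a)" "g ((a \<^bold>\<or> b) \<^bold>\<box>\<rightarrow> b)"
          "g (((a \<^bold>\<or> b) \<^bold>\<box>\<rightarrow> c) \<^bold>\<leftrightarrow> ((a \<^bold>\<box>\<rightarrow> c) \<^bold>\<and> (b \<^bold>\<box>\<rightarrow> c)))"]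
      by (simp add: label_eq_Tru_iff)
  next
    case (4 x y z)
    then show ?case by (auto simp: label_eq_derivable lewis)
  qed
qed

end

section \<open>Embedding the quotient into an infinite type\<close>

instance fm :: countable
  by countable_datatype

text \<open>Each class gets a canonical representative, which is numbered by \<open>to_nat\<close>
  and sent into the type by an injection from the naturals.\<close>

lemma ex_lindenbaum_labelling:
  assumes "infinite (UNIV :: 'a set)"
  shows "\<exists>g :: fm \<Rightarrow> 'a. lindenbaum_labelling \<Gamma> g"
proof -
  obtain f :: "nat \<Rightarrow> 'a" where f: "inj f"
    using infinite_countable_subset[OF assms] by blast
  define rep where "rep \<phi> = (SOME \<psi>. derivable \<Gamma> (\<phi> \<^bold>\<leftrightarrow> \<psi>))" for \<phi>
  have iff_rep: "derivable \<Gamma> (\<phi> \<^bold>\<leftrightarrow> rep \<phi>)" for \<phi>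
    unfolding rep_def by (rule someI[of _ \<phi>]) (simp add: derivable_Con_iff entails_refl)
  have "rep \<phi> = rep \<psi> \<longleftrightarrow> derivable \<Gamma> (\<phi> \<^bold>\<leftrightarrow> \<psi>)" for \<phi> \<psi>
  proof
    assume "rep \<phi> = rep \<psi>"
    then show "derivable \<Gamma> (\<phi> \<^bold>\<leftrightarrow> \<psi>)"
      using iff_rep[of \<phi>] iff_rep[of \<psi>] by (metis derivable_Con_iff entails_trans)
  next
    assume "derivable \<Gamma> (\<phi> \<^bold>\<leftrightarrow> \<psi>)"
    \<comment> \<open>Equivalent formulas give the choice operator the same predicate, so it returns
      the same representative.\<close>
    then have "derivable \<Gamma> (\<phi> \<^bold>\<leftrightarrow> \<chi>) \<longleftrightarrow> derivable \<Gamma> (\<psi> \<^bold>\<leftrightarrow> \<chi>)" for \<chi>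
      by (meson derivable_Con_iff entails_trans)
    then show "rep \<phi> = rep \<psi>" by (simp add: rep_def)
  qed
  then have "lindenbaum_labelling \<Gamma> (f \<circ> to_nat \<circ> rep)"
    by unfold_locales (simp add: inj_eq[OF f])
  then show ?thesis by blast
qed

section \<open>V-algebras form a variety\<close>

text \<open>The inequality \<open>x \<le> y\<close> of axiom (2) is rendered as \<open>x \<and> y \<approx> x\<close>.\<close>

inductive_set V_equations :: "equation set" where
  "((Var 0 \<^bold>\<and> Var 1) \<^bold>\<and> Var 2, Var 0 \<^bold>\<and> (Var 1 \<^bold>\<and> Var 2)) \<in> V_equations"
| "((Var 0 \<^bold>\<or> Var 1) \<^bold>\<or> Var 2, Var 0 \<^bold>\<or> (Var 1 \<^bold>\<or> Var 2)) \<in> V_equations"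
| "(Var 0 \<^bold>\<and> Var 1, Var 1 \<^bold>\<and> Var 0) \<in> V_equations"
| "(Var 0 \<^bold>\<or> Var 1, Var 1 \<^bold>\<or> Var 0) \<in> V_equations"
| "(Var 0 \<^bold>\<and> (Var 0 \<^bold>\<or> Var 1), Var 0) \<in> V_equations"
| "(Var 0 \<^bold>\<or> (Var 0 \<^bold>\<and> Var 1), Var 0) \<in> V_equations"
| "(Var 0 \<^bold>\<and> (Var 1 \<^bold>\<or> Var 2), (Var 0 \<^bold>\<and> Var 1) \<^bold>\<or> (Var 0 \<^bold>\<and> Var 2)) \<in> V_equations"
| "(Var 0 \<^bold>\<or> (Var 1 \<^bold>\<and> Var 2), (Var 0 \<^bold>\<or> Var 1) \<^bold>\<and> (Var 0 \<^bold>\<or> Var 2)) \<in> V_equations"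
| "(Var 0 \<^bold>\<or> \<^bold>0, Var 0) \<in> V_equations"
| "(Var 0 \<^bold>\<and> \<^bold>1, Var 0) \<in> V_equations"
| "(Var 0 \<^bold>\<and> (Var 0 \<^bold>\<rightarrow> \<^bold>0), \<^bold>0) \<in> V_equations"
| "(Var 0 \<^bold>\<or> (Var 0 \<^bold>\<rightarrow> \<^bold>0), \<^bold>1) \<in> V_equations"
| "(Var 0 \<^bold>\<rightarrow> Var 1, (Var 0 \<^bold>\<rightarrow> \<^bold>0) \<^bold>\<or> Var 1) \<in> V_equations"
| "(Var 0 \<^bold>\<box>\<rightarrow> Var 0, \<^bold>1) \<in> V_equations"
| "(((Var 0 \<^bold>\<box>\<rightarrow> Var 1) \<^bold>\<and> (Var 1 \<^bold>\<box>\<rightarrow> Var 0)) \<^bold>\<and>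
      ((Var 0 \<^bold>\<box>\<rightarrow> Var 2) \<^bold>\<leftrightarrow> (Var 1 \<^bold>\<box>\<rightarrow> Var 2)),
    (Var 0 \<^bold>\<box>\<rightarrow> Var 1) \<^bold>\<and> (Var 1 \<^bold>\<box>\<rightarrow> Var 0)) \<in> V_equations"
| "((((Var 0 \<^bold>\<or> Var 1) \<^bold>\<box>\<rightarrow> Var 0) \<^bold>\<or> ((Var 0 \<^bold>\<or> Var 1) \<^bold>\<box>\<rightarrow> Var 1)) \<^bold>\<or>
      (((Var 0 \<^bold>\<or> Var 1) \<^bold>\<box>\<rightarrow> Var 2) \<^bold>\<leftrightarrow> ((Var 0 \<^bold>\<box>\<rightarrow> Var 2) \<^bold>\<and> (Var 1 \<^bold>\<box>\<rightarrow> Var 2))),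
    \<^bold>1) \<in> V_equations"
| "(Var 0 \<^bold>\<box>\<rightarrow> (Var 1 \<^bold>\<and> Var 2), (Var 0 \<^bold>\<box>\<rightarrow> Var 1) \<^bold>\<and> (Var 0 \<^bold>\<box>\<rightarrow> Var 2)) \<in> V_equations"

lemma (in V_algebra) satisfies_V_equations:
  assumes "(s, t) \<in> V_equations" and h: "range h \<subseteq> carrier A"
  shows "satisfies A h (s, t)"
proof -
  have hc: "h n \<in> carrier A" for n using h by blast
  show ?thesis
    using assms(1)
  proof (induction rule: V_equations.induct)
  \<comment> \<open>With the biconditional folded, each equation is literally an axiom at the values
    \<open>h n\<close>.\<close>
  qed (unfold satisfies_def fst_conv snd_conv eval.simps biimpl_def[symmetric],
      (rule meet_assoc join_assoc meet_commute join_commute meet_absorb join_absorb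
        meet_distrib join_distrib join_zero meet_one meet_compl join_compl impl_eq
        cond_refl cond_cong[unfolded leq_def] cond_join cond_meet; rule hc)+)
qed

lemma V_algebra_if_satisfies_V_equations:
  assumes "algebra A"
    and "\<forall>h. range h \<subseteq> carrier A \<longrightarrow> (\<forall>e\<in>V_equations. satisfies A h e)"
  shows "V_algebra A"
proof -
  \<comment> \<open>Three variables suffice for the equations; later ones are also sent to
    \<open>z\<close>, so that the whole valuation stays in the carrier.\<close>
  have "eval A (\<lambda>n. if n = 0 then x else if n = 1 then y else z) s
      = eval A (\<lambda>n. if n = 0 then x else if n = 1 then y else z) t"
    if "(s, t) \<in> V_equations" "x \<in> carrier A" "y \<in> carrier A" "z \<in> carrier A" for s t x y z
  proof -
    have "range (\<lambda>n::nat. if n = 0 then x else if n = 1 then y else z) \<subseteq> carrier A"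
      using that by auto
    from assms(2)[rule_format, OF this that(1)] show ?thesis
      by (simp only: satisfies_def fst_conv snd_conv)
  qed
  note eqs = V_equations.intros[THEN this, simplified]
  have "boolean_alg A"
    by (intro boolean_alg.intro boolean_alg_axioms.intro assms(1)) (rule eqs; assumption)+
  then interpret boolean_alg A .
  show ?thesis
    by unfold_locales (unfold leq_def biimpl_def, (rule eqs; assumption)+)
qed

lemma variety_V_algebras: "variety (V_algebras :: 'a alg set)"
proof -
  have "V_algebra A \<longleftrightarrow>
      algebra A \<and> (\<forall>h. range h \<subseteq> carrier A \<longrightarrow> (\<forall>e\<in>V_equations. satisfies A h e))"
    for A :: "'a alg"
    using V_algebra.satisfies_V_equations V_algebra_if_satisfies_V_equations
      V_algebra.axioms(1) boolean_alg.axioms(1) by fast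
  then show ?thesis unfolding variety_def V_algebras_def by blast
qed

section \<open>GV and equational consequence\<close>

lemma tau_inst_Tru: "tau_inst {(Var 0, \<^bold>1)} \<Gamma> = (\<lambda>\<gamma>. (\<gamma>, \<^bold>1)) ` \<Gamma>"
  by (auto simp: tau_inst_def)

lemma GV_iff_eq_conseq:
  assumes "infinite (UNIV :: 'a set)"
  shows "GV \<Gamma> \<phi> \<longleftrightarrow> eq_conseq (V_algebras :: 'a alg set)
           (tau_inst {(Var 0, \<^bold>1)} \<Gamma>) (tau_inst {(Var 0, \<^bold>1)} {\<phi>})"
  (is "_ \<longleftrightarrow> ?R")
proof
  assume "GV \<Gamma> \<phi>"
  then show ?R
    unfolding GV_eq_derivable
    by (auto simp: eq_conseq_def V_algebras_def tau_inst_Tru satisfies_def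
        intro: V_algebra.derivable_sound)
next
  assume R: ?R
  obtain g :: "fm \<Rightarrow> 'a" where "lindenbaum_labelling \<Gamma> g"
    using ex_lindenbaum_labelling[OF assms] by blast
  then interpret lindenbaum_labelling \<Gamma> g .
  have "range (g \<circ> Var) \<subseteq> carrier (lindenbaum g)" by auto
  moreover have "lindenbaum g \<in> V_algebras" by (simp add: V_algebras_def V_algebra_lindenbaum)
  \<comment> \<open>The consequence is instantiated at the Lindenbaum algebra of \<Gamma> with the
    canonical valuation, where every member of \<Gamma> has value one.\<close>
  ultimately have "(\<forall>\<gamma>\<in>\<Gamma>. g \<gamma> = g \<^bold>1) \<longrightarrow> g \<phi> = g \<^bold>1"
    using R[unfolded eq_conseq_def, THEN bspec[of _ _ "lindenbaum g"],
        THEN spec[of _ "g \<circ> Var"]]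
    by (simp add: tau_inst_Tru satisfies_def eval_lindenbaum)
  then show "GV \<Gamma> \<phi>" by (simp add: label_eq_Tru_iff GV_eq_derivable derivable.hyp)
qed

theorem theorem4p5:
  assumes "infinite (UNIV :: 'a set)"
  shows "variety (V_algebras :: 'a alg set) \<and>
         equivalent_algebraic_semantics GV (V_algebras :: 'a alg set) \<and>
         equivalent_algebraic_semantics_via GV (V_algebras :: 'a alg set)
           {(Var 0, \<^bold>1)} {Var 0 \<^bold>\<leftrightarrow> Var 1}"
proof -
  \<comment> \<open>This gives both directions of the interderivability of x \<approx> y with its
    translation.\<close>
  have "eval A h (Var 0 \<^bold>\<leftrightarrow> Var 1) = \<one>\<^bsub>A\<^esub> \<longleftrightarrow> h 0 = h 1"
    if "V_algebra A" "range h \<subseteq> carrier A" for A :: "'a alg" and h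
  proof -
    interpret V_algebra A by fact
    have "h n \<in> carrier A" for n using that(2) by blast
    then show ?thesis using biimpl_eq_one_iff[of "h 0" "h 1"] by (simp add: biimpl_def)
  qed
  moreover have "Delta_inst {Var 0 \<^bold>\<leftrightarrow> Var 1} (Var 0) (Var 1) = {Var 0 \<^bold>\<leftrightarrow> Var 1}"
    by (auto simp: Delta_inst_def)
  ultimately have "equivalent_algebraic_semantics_via GV (V_algebras :: 'a alg set)
      {(Var 0, \<^bold>1)} {Var 0 \<^bold>\<leftrightarrow> Var 1}"
    \<comment> \<open>Evaluation is not unfolded on the biconditional, so that the equivalence above
      can rewrite it.\<close>
    unfolding equivalent_algebraic_semantics_via_def
    by (simp del: eval.simps add: GV_iff_eq_conseq[OF assms])
      (auto simp del: eval.simps simp: eq_conseq_def V_algebras_def tau_inst_Tru satisfies_def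
        eval.simps(1,3))
  then show ?thesis
    using variety_V_algebras unfolding equivalent_algebraic_semantics_def by blast
qed

end
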